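(* Let $n>p\ge 0$ be integers and let $G$ be a connected graph of order $n$ with exactly $p$ pendant vertices. Then $$EUS(G)\leq \sqrt{3}\binom{n-p-1}{2}(n-p-1)+p\sqrt{n^2-n+1}+(n-p-1)\sqrt{(n-1)(2n-p-2)+(n-p-1)^2},$$ with equality if and only if $G\cong K_{n,p}$.
   Context: For a simple graph $G$, the Euler Sombor index is $EUS(G)=\sum_{v_iv_j\in E(G)}\sqrt{d_i^2+d_j^2+d_id_j}$, where $d_i$ denotes the degree of vertex $v_i$. A pendant vertex is a vertex of degree $1$. $K_{n,p}$ denotes the graph of order $n$ obtained from the complete graph $K_{n-p}$ by attaching $p$ pendant vertices (each joined by an edge) to a single vertex of $K_{n-p}$; in particular $K_{n,0}=K_n$ and $K_{n,n-1}$ is the star $S_n$. *)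

theory Defs
  imports Complex_Main "Graph_Theory.Graph_Theory"
begin

text \<open>
  A finite simple graph is a \<^locale>\<open>pair_graph\<close>: every edge is represented by its two
  opposite arcs, so the degree of a vertex is its out-degree.
\<close>

abbreviation deg :: "'a pair_pre_digraph \<Rightarrow> 'a \<Rightarrow> nat" where
  "deg G v \<equiv> out_degree (with_proj G) v"

definition edges :: "'a pair_pre_digraph \<Rightarrow> 'a set set" where
  "edges G = {{u, v} | u v. (u, v) \<in> parcs G}"

definition pendant_verts :: "'a pair_pre_digraph \<Rightarrow> 'a set" where
  "pendant_verts G = {v \<in> pverts G. deg G v = 1}"

text \<open>
  The Euler Sombor index. The sum and the product over the two endpoints of an edge render
  the summand symmetrically; see \<open>eus_summand\<close>.
\<close>

definition EUS :: "'a pair_pre_digraph \<Rightarrow> real" where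
  "EUS G = (\<Sum>e\<in>edges G. sqrt ((\<Sum>v\<in>e. (real (deg G v))\<^sup>2) + (\<Prod>v\<in>e. real (deg G v))))"

lemma eus_summand:
  assumes "pair_graph G" and "(u, v) \<in> parcs G"
  shows "sqrt ((\<Sum>w\<in>{u, v}. (real (deg G w))\<^sup>2) + (\<Prod>w\<in>{u, v}. real (deg G w)))
       = sqrt ((real (deg G u))\<^sup>2 + (real (deg G v))\<^sup>2 + real (deg G u) * real (deg G v))"
proof -
  interpret pair_graph G by fact
  have "u \<noteq> v" using assms(2) by (rule no_loops')
  then show ?thesis by simp
qed

text \<open>
  The graph \<open>K\<^sub>n\<^sub>,\<^sub>p\<close>, meaningful for \<open>p < n\<close>: the clique is on \<open>0, \<dots>, n - p - 1\<close> and the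
  attached vertices \<open>n - p, \<dots>, n - 1\<close> are all joined to the clique vertex \<open>0\<close>.
\<close>

definition K_pend :: "nat \<Rightarrow> nat \<Rightarrow> nat pair_pre_digraph" where
  "K_pend n p = \<lparr> pverts = {..<n},
     parcs = {(u, v). u < n - p \<and> v < n - p \<and> u \<noteq> v}
       \<union> {0} \<times> {n - p..<n} \<union> {n - p..<n} \<times> {0} \<rparr>"

lemma pair_graph_K_pend:
  assumes "p < n"
  shows "pair_graph (K_pend n p)"
proof -
  have "parcs (K_pend n p) \<subseteq> {..<n} \<times> {..<n}"
    using assms by (auto simp: K_pend_def)
  then have "finite (parcs (K_pend n p))"
    by (rule finite_subset) simp
  then show ?thesis
    using assms
    by unfold_locales (auto simp: K_pend_def symmetric_def sym_def)
qed

lemma K_pend_0: "parcs (K_pend n 0) = {(u, v). u < n \<and> v < n \<and> u \<noteq> v}"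
  by (auto simp: K_pend_def)

lemma K_pend_star:
  assumes "0 < n"
  shows "parcs (K_pend n (n - 1)) = {0} \<times> {1..<n} \<union> {1..<n} \<times> {0}"
  using assms by (auto simp: K_pend_def)

end

theory Submission
  imports Defs
begin

text \<open>
  Summing over arcs gives \<open>2 EUS(G) = \<Sum> w(d(u), d(v))\<close> with \<open>w(x, y) = \<surd>(x\<^sup>2 + y\<^sup>2 + xy)\<close>, a norm on
  the plane that is increasing on the positive quadrant. Let \<open>m = n - p\<close> be the number of
  non-pendant vertices and let \<open>q(v)\<close> be the number of pendant vertices at \<open>v\<close>, so that
  \<open>d(v) \<le> m - 1 + q(v)\<close> and \<open>\<Sum> q(v) = p\<close>. A pendant edge has weight at most \<open>w(1, n - 1)\<close>.
  By convexity of \<open>w\<close>, an edge between non-pendant \<open>u\<close> and \<open>v\<close> has weight at most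
  \<open>w(m - 1, m - 1) + (q(u) + q(v)) s\<close>, where \<open>s\<close> is the slope of the chord from
  \<open>w(m - 1, m - 1)\<close> to \<open>w(m - 1 + p, m - 1)\<close>; this majorant is linear in \<open>q\<close>, and its sum over all
  pairs depends only on \<open>n\<close> and \<open>p\<close>. Equality forces all pairs of non-pendant vertices to be adjacent
  and every neighbour of a pendant vertex to have degree \<open>n - 1\<close>, hence to be the only one.
\<close>

section \<open>The edge weight as a norm on the plane\<close>

definition eus_weight :: "real \<Rightarrow> real \<Rightarrow> real" where
  "eus_weight x y = sqrt (x\<^sup>2 + y\<^sup>2 + x * y)"

lemma eus_weight_commute: "eus_weight x y = eus_weight y x"
  by (simp add: eus_weight_def ac_simps)

text \<open>Completing the square turns the quadratic form into a squared Euclidean length after a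
  linear change of coordinates, so the triangle inequality carries over from the complex
  norm.\<close>

lemma eus_weight_eq_norm: "eus_weight x y = cmod (Complex (x + y / 2) (sqrt 3 / 2 * y))"
proof -
  have "x\<^sup>2 + y\<^sup>2 + x * y = (x + y / 2)\<^sup>2 + (sqrt 3 / 2 * y)\<^sup>2"
    by (simp add: power_mult_distrib power_divide field_simps power2_eq_square)
  then show ?thesis by (simp add: eus_weight_def cmod_def)
qed

lemma eus_weight_triangle:
  "eus_weight (x + x') (y + y') \<le> eus_weight x y + eus_weight x' y'"
proof -
  have "Complex (x + x' + (y + y') / 2) (sqrt 3 / 2 * (y + y'))
      = Complex (x + y / 2) (sqrt 3 / 2 * y) + Complex (x' + y' / 2) (sqrt 3 / 2 * y')"
    by (simp add: complex_eq_iff field_simps)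
  then show ?thesis unfolding eus_weight_eq_norm by (simp only: norm_triangle_ineq)
qed

lemma eus_weight_scale:
  assumes "0 \<le> k"
  shows "eus_weight (k * x) (k * y) = k * eus_weight x y"
proof -
  have "(k * x)\<^sup>2 + (k * y)\<^sup>2 + (k * x) * (k * y) = k\<^sup>2 * (x\<^sup>2 + y\<^sup>2 + x * y)"
    by (simp add: power2_eq_square algebra_simps)
  then show ?thesis using assms by (simp add: eus_weight_def real_sqrt_mult)
qed

lemma eus_weight_mono:
  assumes "0 \<le> x" "x \<le> x'" "0 \<le> y" "y \<le> y'"
  shows "eus_weight x y \<le> eus_weight x' y'"
  unfolding eus_weight_def
  by (intro real_sqrt_le_mono add_mono power_mono mult_mono) (use assms in auto)

lemma eus_weight_strict_mono:
  assumes "0 \<le> y" "y < y'" "0 \<le> x"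
  shows "eus_weight x y < eus_weight x y'"
proof -
  have "y\<^sup>2 < y'\<^sup>2" using assms by (intro power_strict_mono) auto
  moreover have "x * y \<le> x * y'" using assms by (intro mult_left_mono) auto
  ultimately show ?thesis by (simp add: eus_weight_def)
qed

lemma eus_weight_diag:
  assumes "0 \<le> x"
  shows "eus_weight x x = sqrt 3 * x"
proof -
  have "x\<^sup>2 + x\<^sup>2 + x * x = 3 * x\<^sup>2" by (simp add: power2_eq_square)
  then show ?thesis using assms by (simp add: eus_weight_def real_sqrt_mult)
qed

text \<open>For \<open>p = 0\<close> the slope is the junk value \<open>x / 0 = 0\<close>, which is harmless as then \<open>a = b = 0\<close>.\<close>

lemma eus_weight_chord:
  assumes "0 \<le> a" "0 \<le> b" "a + b \<le> p" "0 \<le> M"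
  shows "eus_weight (M + a) (M + b)
    \<le> eus_weight M M + (a + b) * ((eus_weight (M + p) M - eus_weight M M) / p)"
proof (cases "p = 0")
  case True
  then have "a = 0" "b = 0" using assms by auto
  then show ?thesis by simp
next
  case False
  then have p: "0 < p" using assms by linarith
  \<comment> \<open>The point \<open>(M + a, M + b)\<close> is the convex combination of
    \<open>(M + p, M)\<close>, \<open>(M, M + p)\<close> and \<open>(M, M)\<close> with weights
    \<open>a / p\<close>, \<open>b / p\<close> and \<open>?r / p\<close>; multiplying by
    \<open>p\<close> avoids fractions. The first two points have equal weight by symmetry.\<close>
  let ?r = "p - a - b"
  have x: "p * (M + a) = a * (M + p) + (b * M + ?r * M)"
    and y: "p * (M + b) = a * M + (b * (M + p) + ?r * M)"
    by (simp_all add: algebra_simps)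
  have "p * eus_weight (M + a) (M + b) = eus_weight (p * (M + a)) (p * (M + b))"
    using p by (simp add: eus_weight_scale)
  also have "\<dots> \<le> eus_weight (a * (M + p)) (a * M) + eus_weight (b * M + ?r * M) (b * (M + p) + ?r * M)"
    unfolding x y by (rule eus_weight_triangle)
  also have "\<dots> \<le> eus_weight (a * (M + p)) (a * M)
      + (eus_weight (b * M) (b * (M + p)) + eus_weight (?r * M) (?r * M))"
    by (intro add_left_mono eus_weight_triangle)
  also have "\<dots> = a * eus_weight (M + p) M + (b * eus_weight M (M + p) + ?r * eus_weight M M)"
    using assms by (simp add: eus_weight_scale)
  also have "\<dots> = p * eus_weight M M + (a + b) * (eus_weight (M + p) M - eus_weight M M)"
    by (subst eus_weight_commute[of M "M + p"]) (simp add: algebra_simps)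
  finally show ?thesis using p by (simp add: field_simps)
qed

section \<open>Sums over ordered pairs of distinct elements\<close>

lemma card_offdiag:
  assumes "finite C"
  shows "real (card (C \<times> C - Id)) = real (card C) * (real (card C) - 1)"
proof -
  have "Id \<inter> C \<times> C = (\<lambda>u. (u, u)) ` C" by auto
  then have "card (C \<times> C \<inter> Id) = card C"
    by (metis Int_commute card_image inj_on_convol_ident)
  moreover have "card (C \<times> C) = card (C \<times> C \<inter> Id) + card (C \<times> C - Id)"
    using assms by (intro card_Int_Diff) auto
  ultimately have "card C * card C = card C + card (C \<times> C - Id)" by (simp add: card_cartesian_product)
  then have "real (card C * card C) = real (card C + card (C \<times> C - Id))" by (rule arg_cong)
  then show ?thesis by (simp add: algebra_simps)
qed

text \<open>Each element is the first entry of \<open>card C - 1\<close> pairs and the second entry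
  of as many. Hence only the total of \<open>q\<close> matters, which is why the linear majorant has
  a sum independent of how the pendant vertices are distributed.\<close>

lemma sum_offdiag:
  fixes q :: "'b \<Rightarrow> real"
  assumes "finite C"
  shows "(\<Sum>(u, v)\<in>C \<times> C - Id. q u + q v) = 2 * (real (card C) - 1) * sum q C"
proof -
  have d: "C \<times> C \<inter> Id = (\<lambda>u. (u, u)) ` C" by auto
  have "(\<Sum>(u, v)\<in>C \<times> C. q u + q v)
      = (\<Sum>(u, v)\<in>C \<times> C \<inter> Id. q u + q v) + (\<Sum>(u, v)\<in>C \<times> C - Id. q u + q v)"
    using assms by (subst sum.Int_Diff[where B = Id]) auto
  moreover have "(\<Sum>(u, v)\<in>C \<times> C \<inter> Id. q u + q v) = 2 * sum q C"
    unfolding d by (subst sum.reindex) (auto simp: inj_on_def sum_distrib_left)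
  moreover have "(\<Sum>(u, v)\<in>C \<times> C. q u + q v) = 2 * real (card C) * sum q C"
    by (simp add: sum.cartesian_product[symmetric] sum.distrib sum_distrib_left mult.assoc)
  ultimately show ?thesis by (simp add: algebra_simps)
qed

section \<open>The closed form of the bound\<close>

definition eus_bound :: "nat \<Rightarrow> nat \<Rightarrow> real" where
  "eus_bound n p = sqrt 3 * real ((n - p - 1) choose 2) * (real n - real p - 1)
           + real p * sqrt ((real n)\<^sup>2 - real n + 1)
           + (real n - real p - 1)
               * sqrt ((real n - 1) * (2 * real n - real p - 2) + (real n - real p - 1)\<^sup>2)"

text \<open>Doubled, the terms match the arcs of \<open>K_pend n p\<close>:
  \<open>(M + 1) * M\<close> arcs within the clique, counted as if all degrees were
  \<open>M\<close>, a correction for the \<open>2 * M\<close> of them at the vertex of degree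
  \<open>N\<close>, and \<open>2 * p\<close> arcs to or from attached vertices.\<close>

lemma two_eus_bound:
  assumes "p < n"
  defines "M \<equiv> real n - real p - 1" and "N \<equiv> real n - 1"
  shows "2 * eus_bound n p = (M + 1) * M * eus_weight M M
    + 2 * M * (eus_weight N M - eus_weight M M) + 2 * real p * eus_weight 1 N"
proof -
  have M: "M = real (n - p - 1)" using assms(1) by (simp add: M_def of_nat_diff)
  have "2 * real (k choose 2) = real k * (real k - 1)" for k
    by (induction k) (simp_all add: numeral_2_eq_2 algebra_simps)
  then have c: "2 * real ((n - p - 1) choose 2) = M * (M - 1)" by (simp add: M)
  have e1: "eus_weight 1 N = sqrt ((real n)\<^sup>2 - real n + 1)"
    unfolding eus_weight_def N_def by (rule arg_cong[where f = sqrt]) (simp add: power2_eq_square algebra_simps)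
  have e2: "eus_weight N M = sqrt (N * (2 * real n - real p - 2) + M\<^sup>2)"
    unfolding eus_weight_def N_def M_def
    by (rule arg_cong[where f = sqrt]) (simp add: power2_eq_square algebra_simps)
  have e3: "eus_weight M M = sqrt 3 * M" by (rule eus_weight_diag) (simp add: M)
  have "2 * eus_bound n p = sqrt 3 * (2 * real ((n - p - 1) choose 2)) * M
     + 2 * real p * eus_weight 1 N + 2 * M * eus_weight N M"
    unfolding e1 e2 by (simp add: eus_bound_def M_def N_def algebra_simps)
  then show ?thesis unfolding c e3 by (simp add: algebra_simps)
qed

section \<open>Degrees and the index as sums over arcs\<close>

context pair_graph
begin

lemma deg_eq_card: "deg G u = card {v. (u, v) \<in> parcs G}"
proof -
  have "{e \<in> parcs G. fst e = u} = Pair u ` {v. (u, v) \<in> parcs G}" by force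
  then show ?thesis by (simp add: out_degree_def out_arcs_def card_image inj_on_def)
qed

lemma arc_commute: "(u, v) \<in> parcs G \<longleftrightarrow> (v, u) \<in> parcs G"
  by (blast intro: arcs_symmetric)

text \<open>Arcs are grouped by their set of endpoints. Without loops each group consists of two
  opposite arcs, and these have the same weight by symmetry.\<close>

lemma sum_arcs_eq_two_EUS:
  "(\<Sum>(u, v)\<in>parcs G. eus_weight (deg G u) (deg G v)) = 2 * EUS G"
proof -
  let ?w = "\<lambda>(u, v). eus_weight (deg G u) (deg G v)"
  let ?e = "\<lambda>(u, v). {u, v}"
  let ?s = "\<lambda>e. sqrt ((\<Sum>v\<in>e. (real (deg G v))\<^sup>2) + (\<Prod>v\<in>e. real (deg G v)))"
  have im: "?e ` parcs G = edges G" unfolding edges_def by force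
  have "sum ?w (parcs G) = (\<Sum>e\<in>edges G. sum ?w {a \<in> parcs G. ?e a = e})"
    unfolding im[symmetric] by (rule sum.image_gen) (rule pair_finite_arcs)
  also have "\<dots> = (\<Sum>e\<in>edges G. 2 * ?s e)"
  proof (rule sum.cong[OF refl])
    fix e assume "e \<in> edges G"
    then obtain u v where e: "e = {u, v}" and a: "(u, v) \<in> parcs G" by (auto simp: edges_def)
    have "u \<noteq> v" using a by (rule no_loops')
    have "{a \<in> parcs G. ?e a = e} = {(u, v), (v, u)}"
      using a arc_commute by (auto simp: e doubleton_eq_iff)
    then show "sum ?w {a \<in> parcs G. ?e a = e} = 2 * ?s e"
      using \<open>u \<noteq> v\<close> eus_weight_commute[of "deg G v" "deg G u"] eus_summand[OF pair_graph a]
      by (simp add: e eus_weight_def)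
  qed
  finally show ?thesis by (simp add: EUS_def sum_distrib_left)
qed

end

section \<open>The extremal graphs\<close>

text \<open>A label-free description of \<open>K_pend n p\<close> with clique \<open>W\<close> and
  attaching vertex \<open>c\<close>, so that counting takes place inside \<open>G\<close>. It refers
  to the complement of \<open>W\<close> rather than to degrees: for \<open>card W = 2\<close> the
  clique vertex other than \<open>c\<close> has degree 1 too.\<close>

definition clique_with_pendants :: "'a pair_pre_digraph \<Rightarrow> 'a set \<Rightarrow> 'a \<Rightarrow> bool" where
  "clique_with_pendants G W c \<longleftrightarrow> c \<in> W \<and> W \<subseteq> pverts G
     \<and> parcs G = (W \<times> W - Id) \<union> {c} \<times> (pverts G - W) \<union> (pverts G - W) \<times> {c}"

lemma (in pair_graph) two_EUS_clique_with_pendants: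
  assumes "clique_with_pendants G W c"
  defines "n \<equiv> card (pverts G)" and "p \<equiv> card (pverts G - W)"
  defines "M \<equiv> real n - real p - 1" and "N \<equiv> real n - 1"
  shows "2 * EUS G = (M + 1) * M * eus_weight M M
    + 2 * M * (eus_weight N M - eus_weight M M) + 2 * real p * eus_weight 1 N"
proof -
  let ?V = "pverts G"
  let ?w = "\<lambda>(u, v). eus_weight (deg G u) (deg G v)"
  have c: "c \<in> W" and W: "W \<subseteq> ?V"
    and arcs: "parcs G = (W \<times> W - Id) \<union> ({c} \<times> (?V - W) \<union> (?V - W) \<times> {c})"
    using assms(1) by (auto simp: clique_with_pendants_def)
  have fin: "finite W" "finite ?V" using finite_subset[OF W pair_finite_verts] pair_finite_verts by auto
  have n: "n = card W + p" using W fin unfolding n_def p_def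
    by (simp add: card_Diff_subset card_mono)
  have pos: "0 < card W" using c fin by (auto simp: card_gt_0_iff)
  have cW: "real (card W) = M + 1" by (simp add: n M_def)
  have "{v. (c, v) \<in> parcs G} = ?V - {c}" using c W unfolding arcs by auto
  moreover have "c \<in> ?V" using c W by auto
  ultimately have "deg G c = n - 1" by (simp add: deg_eq_card n_def)
  then have dc: "real (deg G c) = N" using n pos by (simp add: N_def)
  have dW: "real (deg G u) = M" if "u \<in> W" "u \<noteq> c" for u
  proof -
    have "{v. (u, v) \<in> parcs G} = W - {u}" using that W unfolding arcs by auto
    then show ?thesis using that fin pos by (simp add: deg_eq_card n M_def)
  qed
  have dP: "real (deg G u) = 1" if "u \<in> ?V - W" for u
  proof -
    have "{v. (u, v) \<in> parcs G} = {c}" using that c unfolding arcs by auto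
    then show ?thesis by (simp add: deg_eq_card)
  qed
  \<comment> \<open>As \<open>u\<close> and \<open>v\<close> are distinct, \<open>q u + q v\<close>
    is 1 if the arc touches \<open>c\<close> and 0 otherwise; this makes the clique weights affine
    in \<open>q\<close>, so that \<open>sum_offdiag\<close> applies.\<close>
  define q where "q = (\<lambda>u. if u = c then 1 else 0 :: real)"
  have sum_q: "sum q W = 1" using c fin by (simp add: q_def)
  have "sum ?w (W \<times> W - Id)
      = (\<Sum>(u, v)\<in>W \<times> W - Id. eus_weight M M + (eus_weight N M - eus_weight M M) * (q u + q v))"
    by (intro sum.cong[OF refl]) (auto simp: q_def dc dW eus_weight_commute[of M N] split: if_splits)
  also have "\<dots> = real (card (W \<times> W - Id)) * eus_weight M M
      + (eus_weight N M - eus_weight M M) * (\<Sum>(u, v)\<in>W \<times> W - Id. q u + q v)"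
    by (simp add: sum.distrib split_def flip: sum_distrib_left)
  also have "(\<Sum>(u, v)\<in>W \<times> W - Id. q u + q v) = 2 * M"
    using sum_offdiag[OF fin(1), of q] sum_q by (simp add: cW)
  finally have s1: "sum ?w (W \<times> W - Id)
      = (M + 1) * M * eus_weight M M + (eus_weight N M - eus_weight M M) * (2 * M)"
    using card_offdiag[OF fin(1)] by (simp add: cW)
  have "sum ?w ({c} \<times> (?V - W)) = (\<Sum>a\<in>{c} \<times> (?V - W). eus_weight 1 N)"
    by (intro sum.cong[OF refl]) (auto simp: dc dP eus_weight_commute[of N 1])
  then have s2: "sum ?w ({c} \<times> (?V - W)) = real p * eus_weight 1 N"
    by (simp add: p_def card_cartesian_product)
  have "sum ?w ((?V - W) \<times> {c}) = (\<Sum>a\<in>(?V - W) \<times> {c}. eus_weight 1 N)"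
    by (intro sum.cong[OF refl]) (auto simp: dc dP)
  then have s3: "sum ?w ((?V - W) \<times> {c}) = real p * eus_weight 1 N"
    by (simp add: p_def card_cartesian_product)
  have "2 * EUS G = sum ?w ((W \<times> W - Id) \<union> ({c} \<times> (?V - W) \<union> (?V - W) \<times> {c}))"
    unfolding arcs[symmetric] by (rule sum_arcs_eq_two_EUS[symmetric])
  also have "\<dots> = sum ?w (W \<times> W - Id) + (sum ?w ({c} \<times> (?V - W)) + sum ?w ((?V - W) \<times> {c}))"
    using c fin by (subst sum.union_disjoint; (subst sum.union_disjoint)?) auto
  finally show ?thesis using s1 s2 s3 by (simp add: algebra_simps)
qed

text \<open>An isomorphism yields \<open>W\<close> and \<open>c\<close> as the preimages of the
  labels below \<open>n - p\<close> and of 0; conversely, the description of the arcs allows any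
  labelling that respects \<open>c\<close>, the rest of \<open>W\<close> and the complement of
  \<open>W\<close>.\<close>

lemma (in pair_graph) digraph_iso_K_pend_iff:
  assumes n: "card (pverts G) = n" and p: "p < n"
  shows "digraph_iso (with_proj G) (with_proj (K_pend n p))
    \<longleftrightarrow> (\<exists>W c. clique_with_pendants G W c \<and> card W = n - p)"
    (is "?L \<longleftrightarrow> ?R")
proof
  assume ?L
  then obtain f where f: "digraph_isomorphism f" and K: "with_proj (K_pend n p) = app_iso f (with_proj G)"
    by (auto simp: digraph_iso_def)
  define h where "h = iso_verts f"
  have inj: "inj_on h (pverts G)" using f by (simp add: digraph_isomorphism_def h_def)
  have im: "h ` pverts G = {..<n}"
    using arg_cong[OF K, of verts] by (simp add: h_def K_pend_def)
  \<comment> \<open>The arcs of a \<open>with_proj\<close> graph are their own pairs of ends, so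
    passing to \<open>arcs_ends\<close> expresses the arc map of \<open>f\<close> through its vertex
    map.\<close>
  have K_arcs: "parcs (K_pend n p) = map_prod h h ` parcs G"
    using arcs_ends_app_iso_eq[OF f] arg_cong[OF K, of arcs_ends] by (simp add: h_def map_prod_def)
  have arc: "(u, v) \<in> parcs G \<longleftrightarrow> (h u, h v) \<in> parcs (K_pend n p)"
    if "u \<in> pverts G" "v \<in> pverts G" for u v
  proof -
    have "parcs G \<subseteq> pverts G \<times> pverts G" by (auto dest: in_arcsD1 in_arcsD2)
    from inj_on_image_mem_iff[OF map_prod_inj_on[OF inj inj] _ this, of "(u, v)"] that
    show ?thesis unfolding K_arcs by simp
  qed
  obtain c where c: "c \<in> pverts G" "h c = 0" 
  proof -
    have "0 \<in> h ` pverts G" unfolding im using p by simp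
    then show thesis using that by auto
  qed
  have hc: "h u = 0 \<longleftrightarrow> u = c" if "u \<in> pverts G" for u
    using that c inj_onD[OF inj] by metis
  define W where "W = {u \<in> pverts G. h u < n - p}"
  have hn: "h u < n" if "u \<in> pverts G" for u using im that by auto
  have "h ` W = {..<n - p}" unfolding W_def
  proof (intro equalityI subsetI)
    fix k assume "k \<in> {..<n - p}"
    then have "k \<in> h ` pverts G" unfolding im by simp
    then show "k \<in> h ` {u \<in> pverts G. h u < n - p}" using \<open>k \<in> {..<n - p}\<close> by auto
  qed auto
  moreover have "inj_on h W" by (rule inj_on_subset[OF inj]) (auto simp: W_def)
  ultimately have "card W = n - p" using card_image[of h W] by simp
  moreover have "(u, v) \<in> parcs G \<longleftrightarrow>
      (u, v) \<in> (W \<times> W - Id) \<union> {c} \<times> (pverts G - W) \<union> (pverts G - W) \<times> {c}" for u v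
  proof (cases "u \<in> pverts G \<and> v \<in> pverts G")
    case True
    then have "h u = h v \<longleftrightarrow> u = v" using inj_onD[OF inj] by metis
    then show ?thesis using True p hn[of u] hn[of v]
      by (auto simp: arc K_pend_def W_def hc)
  next
    case False
    then show ?thesis using c by (auto simp: W_def dest: in_arcsD1 in_arcsD2)
  qed
  then have "clique_with_pendants G W c"
    using c p by (auto simp: clique_with_pendants_def W_def)
  ultimately show ?R by blast
next
  assume ?R
  then obtain W c where cp: "clique_with_pendants G W c" and cW: "card W = n - p" by blast
  then have c: "c \<in> W" and W: "W \<subseteq> pverts G"
    and arcs: "parcs G = (W \<times> W - Id) \<union> {c} \<times> (pverts G - W) \<union> (pverts G - W) \<times> {c}"
    by (auto simp: clique_with_pendants_def)
  have fin: "finite W" "finite (pverts G)" using finite_subset[OF W pair_finite_verts] pair_finite_verts by auto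
  have "card (W - {c}) = card {1..<n - p}" using c fin cW by simp
  then obtain f where f: "bij_betw f (W - {c}) {1..<n - p}"
    using fin finite_same_card_bij by (metis finite_Diff finite_atLeastLessThan)
  have "card (pverts G - W) = card {n - p..<n}"
    using W fin cW n p by (simp add: card_Diff_subset)
  then obtain g where g: "bij_betw g (pverts G - W) {n - p..<n}"
    using fin finite_same_card_bij by (metis finite_Diff finite_atLeastLessThan)
  \<comment> \<open>The three pieces receive the labels 0, \<open>1\<close> to
    \<open>n - p - 1\<close>, and \<open>n - p\<close> to \<open>n - 1\<close>, as in
    \<open>K_pend\<close>.\<close>
  define h where "h u = (if u = c then 0 else if u \<in> W then f u else g u)" for u
  have h0: "h c = 0" by (simp add: h_def)
  have "bij_betw h {c} {0}" by (simp add: h_def bij_betw_def)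
  moreover have h1: "bij_betw h (W - {c}) {1..<n - p}"
    using f by (subst bij_betw_cong[where g = f]) (auto simp: h_def)
  moreover have h2: "bij_betw h (pverts G - W) {n - p..<n}"
    using g c by (subst bij_betw_cong[where g = g]) (auto simp: h_def)
  ultimately have "bij_betw h ({c} \<union> (W - {c}) \<union> (pverts G - W)) ({0} \<union> {1..<n - p} \<union> {n - p..<n})"
    using p by (intro bij_betw_combine) auto
  moreover have "{c} \<union> (W - {c}) \<union> (pverts G - W) = pverts G" using c W by auto
  moreover have "{0} \<union> {1..<n - p} \<union> {n - p..<n} = {..<n}" using p by auto
  ultimately have h: "bij_betw h (pverts G) {..<n}" by simp
  have "bij_betw h ({c} \<union> (W - {c})) ({0} \<union> {1..<n - p})"
    using h1 h0 by (intro bij_betw_combine) auto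
  moreover have "{c} \<union> (W - {c}) = W" "{0} \<union> {1..<n - p} = {..<n - p}" using c p by auto
  ultimately have hW: "bij_betw h W {..<n - p}" by simp
  let ?h2 = "map_prod h h"
  have "?h2 ` (W \<times> W - Id) = {(u, v). u < n - p \<and> v < n - p \<and> u \<noteq> v}"
  proof (intro equalityI subsetI)
    fix a assume "a \<in> {(u, v). u < n - p \<and> v < n - p \<and> u \<noteq> v}"
    then obtain u v where a: "a = (u, v)" "u < n - p" "v < n - p" "u \<noteq> v" by auto
    then have "u \<in> h ` W" "v \<in> h ` W" using bij_betw_imp_surj_on[OF hW] by auto
    then show "a \<in> ?h2 ` (W \<times> W - Id)" using a by force
  next
    fix a assume "a \<in> ?h2 ` (W \<times> W - Id)"
    then obtain u v where a: "a = (h u, h v)" "u \<in> W" "v \<in> W" "u \<noteq> v" by auto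
    then show "a \<in> {(u, v). u < n - p \<and> v < n - p \<and> u \<noteq> v}"
      using bij_betw_imp_surj_on[OF hW] inj_onD[OF bij_betw_imp_inj_on[OF hW]] by auto
  qed
  moreover have "?h2 ` ({c} \<times> (pverts G - W)) = {0} \<times> {n - p..<n}"
    and "?h2 ` ((pverts G - W) \<times> {c}) = {n - p..<n} \<times> {0}"
    using bij_betw_imp_surj_on[OF h2] h0 by (simp_all add: map_prod_surj_on)
  ultimately have K: "?h2 ` parcs G = parcs (K_pend n p)"
    unfolding arcs image_Un by (simp add: K_pend_def)
  define i where "i = \<lparr>iso_verts = h, iso_arcs = ?h2, iso_head = snd, iso_tail = fst\<rparr>"
  have inj: "inj_on h (pverts G)" using h by (rule bij_betw_imp_inj_on)
  have "inj_on ?h2 (parcs G)"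
    by (rule inj_on_subset[OF map_prod_inj_on[OF inj inj]]) (auto dest: in_arcsD1 in_arcsD2)
  then have "digraph_isomorphism i"
    using inj by (auto simp: digraph_isomorphism_def i_def intro: wf_digraph_axioms)
  moreover have "with_proj (K_pend n p) = app_iso i (with_proj G)"
    using K bij_betw_imp_surj_on[OF h]
    by (simp add: app_iso_def i_def with_proj_def K_pend_def)
  ultimately show ?L by (auto simp: digraph_iso_def)
qed


section \<open>The upper bound and its equality case\<close>

context pair_graph
begin

lemma pendant_nbrs:
  assumes "(u, v) \<in> parcs G" and "u \<in> pendant_verts G"
  shows "{x. (u, x) \<in> parcs G} = {v}"
proof -
  have "card {x. (u, x) \<in> parcs G} = 1"
    using assms(2) by (simp add: pendant_verts_def deg_eq_card)
  then obtain w where "{x. (u, x) \<in> parcs G} = {w}" by (rule card_1_singletonE)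
  then show ?thesis using assms(1) by auto
qed

text \<open>Two adjacent pendant vertices form a set closed under adjacency, which by connectedness
  is the whole graph; then no vertex would be non-pendant.\<close>

lemma pendant_nbr_not_pendant:
  assumes "connected (with_proj G)" and "pendant_verts G \<noteq> pverts G"
    and "(u, v) \<in> parcs G" and "u \<in> pendant_verts G"
  shows "v \<notin> pendant_verts G"
proof
  assume v: "v \<in> pendant_verts G"
  have "(v, u) \<in> parcs G" using assms(3) by (rule arcs_symmetric)
  note nbrs = pendant_nbrs[OF assms(3,4)] pendant_nbrs[OF this v]
  obtain w where w: "w \<in> pverts G" "w \<notin> pendant_verts G"
    using assms(2) by (auto simp: pendant_verts_def)
  have "strongly_connected (with_proj G)"
    using sym_arcs assms(1) by (rule symmetric_connected_imp_strongly_connected)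
  then have "u \<rightarrow>\<^sup>*\<^bsub>with_proj G\<^esub> w"
    using w assms(3) by (auto simp: strongly_connected_def dest: in_arcsD1)
  then have "w \<in> {u, v}"
    by (induction rule: reachable_induct) (use nbrs in auto)
  then show False using w v assms(4) by auto
qed

text \<open>Bound and equality case share one proof because the latter reads off the slack in the
  estimates of the former.\<close>

lemma EUS_le_eus_bound:
  assumes conn: "connected (with_proj G)"
    and n: "card (pverts G) = n" and p: "card (pendant_verts G) = p" and pn: "p < n"
  shows "EUS G \<le> eus_bound n p"
    and "EUS G = eus_bound n p \<Longrightarrow> \<exists>W c. clique_with_pendants G W c \<and> card W = n - p"
proof -
  define V where "V = pverts G"
  define P where "P = pendant_verts G"
  define C where "C = V - P"
  define M where "M = real n - real p - 1"
  define N where "N = real n - 1"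
  let ?w = "\<lambda>(u, v). eus_weight (deg G u) (deg G v)"
  have finV: "finite V" unfolding V_def by (rule pair_finite_verts)
  have PV: "P \<subseteq> V" by (auto simp: P_def V_def pendant_verts_def)
  have fin: "finite P" "finite C" using finV PV finite_subset by (auto simp: C_def)
  have cC: "card C = n - p" using PV fin n p by (simp add: C_def card_Diff_subset P_def V_def)
  then have cC': "real (card C) = M + 1" using pn by (simp add: M_def of_nat_diff)
  have C_ne: "C \<noteq> {}" using cC pn by auto
  have M0: "0 \<le> M" using pn by (simp add: M_def)
  have MpN: "M + real p = N" by (simp add: M_def N_def)
  have "pendant_verts G \<noteq> pverts G" using n p pn by auto
  note nonpend = pendant_nbr_not_pendant[OF conn this]
  have "\<forall>u\<in>P. \<exists>v. {v. (u, v) \<in> parcs G} = {v}"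
    by (auto simp: P_def pendant_verts_def deg_eq_card card_1_singleton_iff)
  then obtain nb where nb: "\<And>u. u \<in> P \<Longrightarrow> {v. (u, v) \<in> parcs G} = {nb u}" by metis
  have nb_iff: "(u, v) \<in> parcs G \<longleftrightarrow> v = nb u" if "u \<in> P" for u v
    using nb[OF that] by auto
  have nb_C: "nb u \<in> C" if "u \<in> P" for u
    using nonpend[of u "nb u"] nb_iff[OF that] that in_arcsD2 by (auto simp: C_def P_def V_def)
  define q where "q = (\<lambda>v. real (card {u \<in> P. nb u = v}))"
  have q0: "0 \<le> q v" for v by (simp add: q_def)
  \<comment> \<open>Double counting: each pendant vertex is counted once, at its only neighbour,
    which lies in \<open>C\<close>.\<close>
  have "(\<Sum>v\<in>C. \<Sum>u\<in>{u \<in> P. nb u = v}. 1 :: real) = (\<Sum>u\<in>P. 1)"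
    using fin nb_C by (intro sum.group) auto
  then have sum_q: "sum q C = real p" using p by (simp add: q_def P_def)
  have deg_le: "real (deg G v) \<le> M + q v" if "v \<in> C" for v
  proof -
    \<comment> \<open>A neighbour of \<open>v\<close> is either one of the other
      \<open>card C - 1 = M\<close> non-pendant vertices or a pendant vertex attached to
      \<open>v\<close>.\<close>
    have "{u. (v, u) \<in> parcs G} \<subseteq> (C - {v}) \<union> {u \<in> P. nb u = v}"
    proof
      fix u assume "u \<in> {u. (v, u) \<in> parcs G}"
      then have a: "(v, u) \<in> parcs G" "(u, v) \<in> parcs G" by (auto simp: arc_commute)
      have "u \<in> V" "u \<noteq> v" using a no_loops' by (auto simp: V_def dest: in_arcsD1)
      then show "u \<in> (C - {v}) \<union> {u \<in> P. nb u = v}"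
        using a nb_iff[of u v] by (auto simp: C_def)
    qed
    then have "deg G v \<le> card ((C - {v}) \<union> {u \<in> P. nb u = v})"
      unfolding deg_eq_card using fin by (intro card_mono) auto
    also have "\<dots> \<le> (card C - 1) + card {u \<in> P. nb u = v}"
      using card_Un_le[of "C - {v}"] that fin by (metis card_Diff_singleton)
    finally have "real (deg G v) \<le> real (card C - 1) + q v" unfolding q_def by linarith
    also have "real (card C - 1) = M" using cC pn by (simp add: M_def of_nat_diff)
    finally show ?thesis .
  qed
  define s where "s = (eus_weight N M - eus_weight M M) / real p"
  \<comment> \<open>For \<open>p = 0\<close> both sides vanish, since then
    \<open>N = M\<close>.\<close>
  have ps: "real p * s = eus_weight N M - eus_weight M M"
    using MpN by (cases "p = 0") (auto simp: s_def)
  have s0: "0 \<le> s"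
    using eus_weight_mono[of M N M M] M0 MpN by (auto simp: s_def)
  define g where "g = (\<lambda>(u, v). eus_weight M M + (q u + q v) * s)"
  have g0: "0 \<le> g a" for a
    by (cases a) (use q0 s0 in \<open>simp add: g_def eus_weight_eq_norm\<close>)
  let ?A = "parcs G \<inter> C \<times> C"
  have A_sub: "?A \<subseteq> C \<times> C - Id" using no_loops' by auto
  have w_le_g: "?w a \<le> g a" if "a \<in> ?A" for a
  proof -
    obtain u v where a: "a = (u, v)" by (cases a)
    then have uv: "u \<in> C" "v \<in> C" "u \<noteq> v" using that no_loops' by auto
    \<comment> \<open>Distinct endpoints share no pendant vertex, which gives the hypothesis
      \<open>a + b \<le> p\<close> of \<open>eus_weight_chord\<close>.\<close>
    have "sum q {u, v} \<le> sum q C" using uv fin q0 by (intro sum_mono2) auto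
    then have "q u + q v \<le> real p" using uv sum_q by simp
    then have "eus_weight (M + q u) (M + q v) \<le> g a"
      using eus_weight_chord[of "q u" "q v" "real p" M] q0 M0 by (simp add: a g_def s_def MpN)
    moreover have "?w a \<le> eus_weight (M + q u) (M + q v)"
      unfolding a prod.case using deg_le uv by (intro eus_weight_mono) auto
    ultimately show ?thesis by linarith
  qed
  have sum_g: "sum g (C \<times> C - Id) = (M + 1) * M * eus_weight M M
      + 2 * M * (eus_weight N M - eus_weight M M)"
  proof -
    have "sum g (C \<times> C - Id) = real (card (C \<times> C - Id)) * eus_weight M M
        + (\<Sum>(u, v)\<in>C \<times> C - Id. q u + q v) * s"
      by (simp add: g_def sum.distrib split_def flip: sum_distrib_right)
    also have "\<dots> = (M + 1) * M * eus_weight M M + 2 * M * (real p * s)"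
      using card_offdiag[OF fin(2)] sum_offdiag[OF fin(2), of q] sum_q by (simp add: cC')
    finally show ?thesis by (simp add: ps)
  qed
  \<comment> \<open>The majorant is summed over all pairs in \<open>C\<close>, adjacent or not. The
    contribution of the missing pairs is nonnegative and is kept in \<open>A_le\<close> as slack for
    the equality case.\<close>
  have "sum ?w ?A \<le> sum g ?A" using w_le_g by (rule sum_mono)
  moreover have g_split: "sum g (C \<times> C - Id) = sum g (C \<times> C - Id - ?A) + sum g ?A"
    using A_sub fin by (intro sum.subset_diff) auto
  moreover have g_rest: "0 \<le> sum g (C \<times> C - Id - ?A)" using g0 by (rule sum_nonneg)
  ultimately have A_le: "sum ?w ?A \<le> sum g (C \<times> C - Id) - sum g (C \<times> C - Id - ?A)" by linarith
  let ?B = "\<Sum>u\<in>P. eus_weight 1 (deg G (nb u))"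
  have degP: "deg G u = 1" if "u \<in> P" for u using that by (simp add: P_def pendant_verts_def)
  have deg_le_N: "real (deg G v) \<le> N" if "v \<in> V" for v
  proof -
    have "{u. (v, u) \<in> parcs G} \<subseteq> V - {v}" using no_loops' by (auto simp: V_def dest: in_arcsD2)
    then have "deg G v \<le> card (V - {v})" unfolding deg_eq_card using finV by (intro card_mono) auto
    then have "deg G v \<le> n - 1" using that finV n by (simp add: V_def)
    then show ?thesis using pn by (simp add: N_def)
  qed
  have B_term: "eus_weight 1 (deg G (nb u)) \<le> eus_weight 1 N" if "u \<in> P" for u
    using nb_C[OF that] deg_le_N by (intro eus_weight_mono) (auto simp: C_def)
  have B_le: "?B \<le> real p * eus_weight 1 N"
    using sum_mono[of P, OF B_term] p by (simp add: P_def)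
  \<comment> \<open>Every arc joins two non-pendant vertices or is one of the two orientations of a
    pendant edge.\<close>
  have arcs: "parcs G = ?A \<union> ((\<lambda>u. (u, nb u)) ` P \<union> (\<lambda>u. (nb u, u)) ` P)"
  proof (intro equalityI subsetI)
    fix a assume "a \<in> parcs G"
    then obtain u v where a: "a = (u, v)" "(u, v) \<in> parcs G" "(v, u) \<in> parcs G"
      by (cases a) (auto simp: arc_commute)
    then have "u \<in> V" "v \<in> V" by (auto simp: V_def dest: in_arcsD1)
    then show "a \<in> ?A \<union> ((\<lambda>u. (u, nb u)) ` P \<union> (\<lambda>u. (nb u, u)) ` P)"
      using a nb_iff[of u v] nb_iff[of v u] by (auto simp: C_def)
  next
    fix a assume "a \<in> ?A \<union> ((\<lambda>u. (u, nb u)) ` P \<union> (\<lambda>u. (nb u, u)) ` P)"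
    then show "a \<in> parcs G" using nb_iff arc_commute by auto
  qed
  have B1: "sum ?w ((\<lambda>u. (u, nb u)) ` P) = ?B"
    by (subst sum.reindex) (auto simp: inj_on_def degP)
  have B2: "sum ?w ((\<lambda>u. (nb u, u)) ` P) = ?B"
    by (subst sum.reindex) (auto simp: inj_on_def degP eus_weight_commute[of _ 1])
  have "2 * EUS G = sum ?w (?A \<union> ((\<lambda>u. (u, nb u)) ` P \<union> (\<lambda>u. (nb u, u)) ` P))"
    unfolding arcs[symmetric] by (rule sum_arcs_eq_two_EUS[symmetric])
  also have "\<dots> = sum ?w ?A + sum ?w ((\<lambda>u. (u, nb u)) ` P \<union> (\<lambda>u. (nb u, u)) ` P)"
    using fin pair_finite_arcs nb_C by (intro sum.union_disjoint) (auto simp: C_def)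
  also have "sum ?w ((\<lambda>u. (u, nb u)) ` P \<union> (\<lambda>u. (nb u, u)) ` P)
      = sum ?w ((\<lambda>u. (u, nb u)) ` P) + sum ?w ((\<lambda>u. (nb u, u)) ` P)"
    using fin nb_C by (intro sum.union_disjoint) (auto simp: C_def)
  also note B1
  also note B2
  finally have eus: "2 * EUS G = sum ?w ?A + 2 * ?B" by simp
  have bound: "2 * eus_bound n p = sum g (C \<times> C - Id) + 2 * (real p * eus_weight 1 N)"
    using two_eus_bound[OF pn] unfolding sum_g M_def N_def by simp
  show "EUS G \<le> eus_bound n p" using eus bound A_le B_le g_rest by linarith
  assume eq: "EUS G = eus_bound n p"
  \<comment> \<open>Equality leaves no slack in \<open>A_le\<close> or \<open>B_le\<close>.\<close>
  have g_rest_0: "sum g (C \<times> C - Id - ?A) = 0" and B_eq: "?B = real p * eus_weight 1 N"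
    using eq eus bound A_le B_le g_rest by linarith+
  have "finite (C \<times> C - Id - ?A)" using fin by simp
  from sum_nonneg_0[OF this g0 g_rest_0]
  have g_0: "g a = 0" if "a \<in> C \<times> C - Id - ?A" for a using that .
  have C_complete: "C \<times> C - Id \<subseteq> parcs G"
  proof (rule ccontr)
    assume "\<not> ?thesis"
    then obtain u v where uv: "(u, v) \<in> C \<times> C - Id - ?A" by auto
    then have "{u, v} \<subseteq> C" "u \<noteq> v" by auto
    \<comment> \<open>A missing pair forces \<open>M \<ge> 1\<close>, so \<open>g\<close> is at
      least \<open>sqrt 3 * M > 0\<close> there, although it must vanish.\<close>
    then have "2 \<le> card C" using card_mono[OF fin(2), of "{u, v}"] by simp
    then have "0 < eus_weight M M" using cC' by (simp add: eus_weight_diag)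
    moreover have "0 \<le> (q u + q v) * s" using q0 s0 by simp
    ultimately show False using g_0[OF uv] by (simp add: g_def)
  qed
  have deg_nb: "real (deg G (nb u)) = N" if "u \<in> P" for u
  proof (rule ccontr)
    assume "real (deg G (nb u)) \<noteq> N"
    then have "real (deg G (nb u)) < N" using deg_le_N[of "nb u"] nb_C[OF that] by (auto simp: C_def)
    then have "eus_weight 1 (deg G (nb u)) < eus_weight 1 N" by (intro eus_weight_strict_mono) auto
    then have "?B < (\<Sum>u\<in>P. eus_weight 1 N)"
      using B_term that fin by (intro sum_strict_mono_ex1) auto
    then show False using B_eq p by (simp add: P_def)
  qed
  \<comment> \<open>A neighbour of a pendant vertex has degree \<open>n - 1\<close>, so it is
    adjacent to every pendant vertex and is the only neighbour of each. Without pendant vertices any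
    element of \<open>C\<close> serves.\<close>
  have "\<exists>c\<in>C. \<forall>u\<in>P. nb u = c"
  proof (cases "P = {}")
    case True
    then show ?thesis using C_ne by auto
  next
    case False
    then obtain u0 where u0: "u0 \<in> P" by auto
    let ?c = "nb u0"
    have c: "?c \<in> C" using u0 by (rule nb_C)
    have "card {v. (?c, v) \<in> parcs G} = n - 1"
      using deg_nb[OF u0] pn unfolding deg_eq_card N_def by linarith
    moreover have "{v. (?c, v) \<in> parcs G} \<subseteq> V - {?c}"
      using no_loops' by (auto simp: V_def dest: in_arcsD2)
    moreover have "card (V - {?c}) = n - 1" using c finV n by (simp add: C_def V_def)
    ultimately have all: "{v. (?c, v) \<in> parcs G} = V - {?c}"
      using finV by (intro card_subset_eq) auto
    have "nb u = ?c" if "u \<in> P" for u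
    proof -
      have "u \<in> V - {?c}" using that c PV by (auto simp: C_def)
      then have "(u, ?c) \<in> parcs G" using all arc_commute by blast
      then show ?thesis using nb_iff[OF that] by simp
    qed
    then show ?thesis using c by blast
  qed
  then obtain c where c: "c \<in> C" "\<And>u. u \<in> P \<Longrightarrow> nb u = c" by blast
  have "?A = C \<times> C - Id" using A_sub C_complete by auto
  moreover have "(\<lambda>u. (u, nb u)) ` P = P \<times> {c}" "(\<lambda>u. (nb u, u)) ` P = {c} \<times> P"
    using c(2) by auto
  moreover have "V - C = P" using PV by (auto simp: C_def)
  ultimately have "clique_with_pendants G C c"
    using arcs c(1) unfolding clique_with_pendants_def V_def[symmetric] by (auto simp: C_def)
  then show "\<exists>W c. clique_with_pendants G W c \<and> card W = n - p" using cC by blast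
qed

end

theorem theorem4:
  fixes G :: "'a pair_pre_digraph" and n p :: nat
  assumes "p < n"
    and "pair_graph G"
    and "Digraph_Component.connected (with_proj G)"
    and "card (pverts G) = n"
    and "card (pendant_verts G) = p"
  shows "EUS G \<le> sqrt 3 * real ((n - p - 1) choose 2) * (real n - real p - 1)
           + real p * sqrt ((real n)\<^sup>2 - real n + 1)
           + (real n - real p - 1)
               * sqrt ((real n - 1) * (2 * real n - real p - 2) + (real n - real p - 1)\<^sup>2)
    \<and> (EUS G = sqrt 3 * real ((n - p - 1) choose 2) * (real n - real p - 1)
           + real p * sqrt ((real n)\<^sup>2 - real n + 1)
           + (real n - real p - 1)
               * sqrt ((real n - 1) * (2 * real n - real p - 2) + (real n - real p - 1)\<^sup>2)
       \<longleftrightarrow> digraph_iso (with_proj G) (with_proj (K_pend n p)))"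
proof -
  interpret pair_graph G by fact
  note bound = EUS_le_eus_bound[OF assms(3,4,5,1)]
  \<comment> \<open>The converse of the equality case: the shape determines \<open>EUS G\<close>,
    and \<open>card W = n - p\<close> leaves exactly \<open>p\<close> vertices outside
    \<open>W\<close>.\<close>
  have "EUS G = eus_bound n p" if "clique_with_pendants G W c" "card W = n - p" for W c
  proof -
    have "W \<subseteq> pverts G" using that(1) by (simp add: clique_with_pendants_def)
    then have "card (pverts G - W) = p"
      using finite_subset[OF _ pair_finite_verts] assms(1,4) that(2) by (simp add: card_Diff_subset)
    then show ?thesis
      using two_EUS_clique_with_pendants[OF that(1)] two_eus_bound[OF assms(1)] assms(4) by simp
  qed
  then have "EUS G \<le> eus_bound n p
      \<and> (EUS G = eus_bound n p \<longleftrightarrow> digraph_iso (with_proj G) (with_proj (K_pend n p)))"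
    using bound digraph_iso_K_pend_iff[OF assms(4,1)] by blast
  then show ?thesis unfolding eus_bound_def .
qed

end
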